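(* The coefficient matrix of the system of constraints $$\sum_{i\in S_n}\sum_{j\in C_i}x_{i,j}^n=1\quad(\forall n\in\mathcal{N}),\qquad \sum_{n\in\mathcal{N}_i}x_{i,j}^n\le1\quad(\forall i\in\{1,\dots,M\},\ \forall j\in C_i)$$ in the variables $x_{i,j}^n$ ($n\in\mathcal{N}$, $i\in S_n$, $j\in C_i$) is totally unimodular.
   Context: $\mathcal{N}=\{1,\dots,N\}$ is a finite set of service requests. There are $M$ service providers, indexed by $i\in\{1,\dots,M\}$; provider $i$ offers a finite set $C_i$ of candidate services, indexed by $j\in C_i$ (services of different providers are regarded as distinct). For each $n\in\mathcal{N}$, $S_n\subseteq\{1,\dots,M\}$ is the set of providers request $n$ may select from, and $\mathcal{N}_i=\{n\in\mathcal{N}: i\in S_n\}$. The coefficient matrix has one row for each $n\in\mathcal{N}$ (first family of constraints) and one row for each pair $(i,j)$ with $1\le i\le M$, $j\in C_i$ (second family), hence $N+\sum_{i=1}^M|C_i|$ rows, and one column for each triple $(n,i,j)$ with $n\in\mathcal{N}$, $i\in S_n$, $j\in C_i$, hence $\sum_{n\in\mathcal{N}}\sum_{i\in S_n}|C_i|$ columns; its entries are the coefficients of the variables $x_{i,j}^n$ in the corresponding constraints. *)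

theory Defs
  imports "Jordan_Normal_Form.Determinant" "Jordan_Normal_Form.DL_Submatrix"
begin

definition totally_unimodular :: "real mat \<Rightarrow> bool" where
  "totally_unimodular A \<longleftrightarrow>
     (\<forall>I J. I \<subseteq> {..<dim_row A} \<longrightarrow> J \<subseteq> {..<dim_col A} \<longrightarrow> card I = card J \<longrightarrow>
        det (submatrix A I J) \<in> {-1, 0, 1})"

text \<open>
  Throughout, \<open>S n\<close> is the set of providers admissible for request \<open>n\<close>, and \<open>C i\<close> is the set
  of candidate services of provider \<open>i\<close>. A service is always named together with its provider, as a
  pair \<open>(i, j)\<close> with \<open>j \<in> C i\<close>, so services of different providers are distinct even if the
  sets \<open>C i\<close> overlap. The triple \<open>(n, i, j)\<close> names the variable \<open>x\<^sub>i\<^sub>j\<^sup>n\<close>.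
\<close>

datatype 'c constraint =
    Assignment nat
  | Capacity nat 'c

definition requests_of :: "nat \<Rightarrow> (nat \<Rightarrow> nat set) \<Rightarrow> nat \<Rightarrow> nat set" where
  "requests_of N S i = {n \<in> {1..N}. i \<in> S n}"

definition constraints :: "nat \<Rightarrow> nat \<Rightarrow> (nat \<Rightarrow> 'c set) \<Rightarrow> 'c constraint set" where
  "constraints N M C =
     Assignment ` {1..N} \<union> {Capacity i j | i j. i \<in> {1..M} \<and> j \<in> C i}"

definition variables :: "nat \<Rightarrow> (nat \<Rightarrow> nat set) \<Rightarrow> (nat \<Rightarrow> 'c set) \<Rightarrow> (nat \<times> nat \<times> 'c) set" where
  "variables N S C = {(n, i, j). n \<in> {1..N} \<and> i \<in> S n \<and> j \<in> C i}"

fun lhs :: "nat \<Rightarrow> (nat \<Rightarrow> nat set) \<Rightarrow> (nat \<Rightarrow> 'c set) \<Rightarrow> 'c constraint \<Rightarrow>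
    (nat \<times> nat \<times> 'c \<Rightarrow> real) \<Rightarrow> real" where
  "lhs N S C (Assignment n) x = (\<Sum>i\<in>S n. \<Sum>j\<in>C i. x (n, i, j))"
| "lhs N S C (Capacity i j) x = (\<Sum>n\<in>requests_of N S i. x (n, i, j))"

text \<open>
  The coefficient of a variable in a linear form is the value of the form at the corresponding
  unit vector; \<open>lhs_eq_sum_coefficient\<close> below confirms that these are the coefficients of
  \<open>lhs\<close>.
\<close>

definition coefficient :: "nat \<Rightarrow> (nat \<Rightarrow> nat set) \<Rightarrow> (nat \<Rightarrow> 'c set) \<Rightarrow> 'c constraint \<Rightarrow>
    nat \<times> nat \<times> 'c \<Rightarrow> real" where
  "coefficient N S C r v = lhs N S C r (\<lambda>w. if w = v then 1 else 0)"

text \<open>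
  The lists \<open>rs\<close> and \<open>cs\<close> fix the order of the rows and of the columns; they are meant to
  enumerate \<open>constraints\<close> and \<open>variables\<close> without repetition.
\<close>

definition coefficient_matrix :: "nat \<Rightarrow> (nat \<Rightarrow> nat set) \<Rightarrow> (nat \<Rightarrow> 'c set) \<Rightarrow>
    'c constraint list \<Rightarrow> (nat \<times> nat \<times> 'c) list \<Rightarrow> real mat" where
  "coefficient_matrix N S C rs cs =
     mat (length rs) (length cs) (\<lambda>(k, l). coefficient N S C (rs ! k) (cs ! l))"

lemma lhs_sum:
  assumes "finite A"
  shows "lhs N S C r (\<lambda>w. \<Sum>v\<in>A. f v * g v w) = (\<Sum>v\<in>A. f v * lhs N S C r (g v))"
proof (cases r)
  case (Assignment n)
  have "(\<Sum>i\<in>S n. \<Sum>j\<in>C i. \<Sum>v\<in>A. f v * g v (n, i, j))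
      = (\<Sum>i\<in>S n. \<Sum>v\<in>A. \<Sum>j\<in>C i. f v * g v (n, i, j))"
    by (intro sum.cong refl) (rule sum.swap)
  also have "\<dots> = (\<Sum>v\<in>A. \<Sum>i\<in>S n. \<Sum>j\<in>C i. f v * g v (n, i, j))"
    by (rule sum.swap)
  finally show ?thesis
    using Assignment by (simp add: sum_distrib_left)
next
  case (Capacity i j)
  have "(\<Sum>n\<in>requests_of N S i. \<Sum>v\<in>A. f v * g v (n, i, j))
      = (\<Sum>v\<in>A. \<Sum>n\<in>requests_of N S i. f v * g v (n, i, j))"
    by (rule sum.swap)
  then show ?thesis
    using Capacity by (simp add: sum_distrib_left)
qed

lemma finite_variables:
  assumes "\<And>n. n \<in> {1..N} \<Longrightarrow> S n \<subseteq> {1..M}"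
    and "\<And>i. i \<in> {1..M} \<Longrightarrow> finite (C i)"
  shows "finite (variables N S C)"
proof -
  have "variables N S C \<subseteq> {1..N} \<times> (SIGMA i:{1..M}. C i)"
    using assms(1) by (fastforce simp: variables_def)
  moreover have "finite ({1..N} \<times> (SIGMA i:{1..M}. C i))"
    using assms(2) by (intro finite_cartesian_product finite_SigmaI) auto
  ultimately show ?thesis
    by (rule finite_subset)
qed

lemma lhs_eq_sum_coefficient:
  assumes S: "\<And>n. n \<in> {1..N} \<Longrightarrow> S n \<subseteq> {1..M}"
    and C: "\<And>i. i \<in> {1..M} \<Longrightarrow> finite (C i)"
    and r: "r \<in> constraints N M C"
  shows "lhs N S C r x = (\<Sum>v\<in>variables N S C. coefficient N S C r v * x v)"
proof -
  note fin = finite_variables[of N S M C, OF S C]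
  define y where "y = (\<lambda>w. \<Sum>v\<in>variables N S C. x v * (if w = v then 1 else 0))"
  have y: "y w = x w" if "w \<in> variables N S C" for w
    using that fin by (simp add: y_def if_distrib sum.delta cong: if_cong)
  have "lhs N S C r x = lhs N S C r y"
    using r y by (cases r)
      (auto simp: constraints_def variables_def requests_of_def intro!: sum.cong)
  also have "\<dots> = (\<Sum>v\<in>variables N S C. x v * coefficient N S C r v)"
    unfolding y_def coefficient_def by (rule lhs_sum[OF fin])
  finally show ?thesis
    by (simp add: mult.commute)
qed

end

theory Submission
  imports Defs
begin

text \<open>
  Each column has at most one nonzero entry among the assignment rows and at most one among the
  capacity rows. For a square submatrix, either some column has at most one nonzero entry, and one
  expands the determinant along it, or every column has exactly one entry \<open>1\<close> in each of the two
  classes of rows; then the sum of the rows of one class equals the sum of the rows of the other,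
  so the determinant vanishes.
\<close>

text \<open>The signs form a vector in the kernel of the transpose. It is nonzero because
  \<open>0 < n\<close> and neither 1 nor -1 vanishes in an integral domain.\<close>

lemma det_eq_0_of_signed_row_sum:
  fixes A :: "'a :: idom mat"
  assumes A: "A \<in> carrier_mat n n" and "0 < n"
    and P: "\<And>l. l < n \<Longrightarrow> (\<Sum>k<n. A $$ (k, l) * (if P k then 1 else -1)) = 0"
  shows "det A = 0"
proof -
  define v :: "'a vec" where "v = vec n (\<lambda>k. if P k then 1 else -1)"
  have "A\<^sup>T *\<^sub>v v = 0\<^sub>v n"
    using A P by (intro eq_vecI) (auto simp: v_def scalar_prod_def lessThan_atLeast0)
  moreover have "v \<noteq> 0\<^sub>v n"
  proof
    assume "v = 0\<^sub>v n"
    then have "v $ 0 = 0" using \<open>0 < n\<close> by simp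
    then show False using \<open>0 < n\<close> by (simp add: v_def split: if_splits)
  qed
  moreover have "v \<in> carrier_vec n" by (simp add: v_def)
  ultimately have "det A\<^sup>T = 0"
    using A by (subst det_0_iff_vec_prod_zero[of _ n]) auto
  then show ?thesis by (simp add: det_transpose[OF A])
qed

lemma det_expand_singleton_column:
  fixes A :: "'a :: comm_ring_1 mat"
  assumes A: "A \<in> carrier_mat n n" and "k < n" "l < n"
    and zero: "\<And>k'. k' < n \<Longrightarrow> k' \<noteq> k \<Longrightarrow> A $$ (k', l) = 0"
  shows "det A = A $$ (k, l) * (-1) ^ (k + l) * det (mat_delete A k l)"
proof -
  have "det A = (\<Sum>i<n. A $$ (i, l) * cofactor A i l)"
    by (rule laplace_expansion_column[OF A \<open>l < n\<close>])
  also have "\<dots> = (\<Sum>i<n. if i = k then A $$ (k, l) * cofactor A k l else 0)"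
    using zero by (intro sum.cong) auto
  also have "\<dots> = A $$ (k, l) * cofactor A k l"
    using \<open>k < n\<close> by simp
  finally show ?thesis by (simp add: cofactor_def mult.assoc)
qed

text \<open>The predicate \<open>P\<close> says which class a row belongs to. It must vary in the
  induction: deleting row \<open>k\<close> renumbers the rows, so the minor carries the class
  predicate composed with \<open>insert_index k\<close>.\<close>

lemma det_two_class_rows:
  fixes A :: "'a :: idom mat" and P :: "nat \<Rightarrow> bool"
  assumes "A \<in> carrier_mat n n"
    and "\<And>k l. k < n \<Longrightarrow> l < n \<Longrightarrow> A $$ (k, l) \<in> {0, 1}"
    and "\<And>k k' l. \<lbrakk>k < n; k' < n; l < n; P k = P k'; A $$ (k, l) \<noteq> 0; A $$ (k', l) \<noteq> 0\<rbrakk> \<Longrightarrow> k = k'"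
  shows "det A \<in> {-1, 0, 1}"
  using assms
proof (induction n arbitrary: A P)
  case 0
  then show ?case by simp
next
  case (Suc n)
  note A = Suc.prems(1) and entry = Suc.prems(2) and unique = Suc.prems(3)
  show ?case
  \<comment> \<open>This also covers a zero column, for which any \<open>k\<close> serves.\<close>
  proof (cases "\<exists>k<Suc n. \<exists>l<Suc n. \<forall>k'<Suc n. k' \<noteq> k \<longrightarrow> A $$ (k', l) = 0")
    case True
    then obtain k l where kl: "k < Suc n" "l < Suc n"
      and zero: "\<And>k'. k' < Suc n \<Longrightarrow> k' \<noteq> k \<Longrightarrow> A $$ (k', l) = 0" by blast
    let ?D = "mat_delete A k l"
    have ins: "insert_index i j < Suc n" if "j < n" for i j
      using that by (simp add: insert_index_def)
    have D: "?D $$ (a, b) = A $$ (insert_index k a, insert_index l b)" if "a < n" "b < n" for a b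
      using mat_delete_index[OF A kl that] by simp
    have "det ?D \<in> {-1, 0, 1}"
    proof (rule Suc.IH[of ?D "\<lambda>a. P (insert_index k a)"])
      show "?D \<in> carrier_mat n n"
        using mat_delete_carrier[OF A] by simp
      show "?D $$ (a, b) \<in> {0, 1}" if "a < n" "b < n" for a b
        unfolding D[OF that] using that by (intro entry ins)
      show "a = a'"
        if "a < n" "a' < n" "b < n" "P (insert_index k a) = P (insert_index k a')"
          "?D $$ (a, b) \<noteq> 0" "?D $$ (a', b) \<noteq> 0" for a a' b
      proof -
        have "insert_index k a = insert_index k a'"
          using that by (intro unique[of _ _ "insert_index l b"] ins) (auto simp: D)
        then show ?thesis
          \<comment> \<open>\<open>delete_index k\<close> is a left inverse of
            \<open>insert_index k\<close>, which is therefore injective.\<close>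
          by (metis delete_insert_index)
      qed
    qed
    moreover have "A $$ (k, l) \<in> {0, 1}" using entry kl by blast
    moreover have "(-1 :: 'a) ^ (k + l) \<in> {-1, 1}"
      by (cases "even (k + l)") auto
    moreover have "det A = A $$ (k, l) * (-1) ^ (k + l) * det ?D"
      by (rule det_expand_singleton_column[OF A kl zero])
    ultimately show ?thesis by auto
  next
    case False
    have "det A = 0"
    proof (rule det_eq_0_of_signed_row_sum[OF A])
      fix l assume l: "l < Suc n"
      \<comment> \<open>The negated case condition is used twice: for an arbitrary row it yields a
        nonzero entry of column \<open>l\<close>, and for that row \<open>k\<close> it yields a
        second one.\<close>
      obtain k where k: "k < Suc n" "A $$ (k, l) \<noteq> 0"
        using False l by blast
      obtain k' where k': "k' < Suc n" "k' \<noteq> k" "A $$ (k', l) \<noteq> 0"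
        using False l k by blast
      have P: "P k \<noteq> P k'" using unique k k' l by blast
      have others: "A $$ (i, l) = 0" if "i < Suc n" "i \<notin> {k, k'}" for i
      proof (rule ccontr)
        assume nz: "A $$ (i, l) \<noteq> 0"
        \<comment> \<open>With only two classes, a third nonzero entry would share its class with
          one of the first two.\<close>
        have "P i = P k \<or> P i = P k'" using P by blast
        then have "i = k \<or> i = k'"
          using unique[OF that(1) k(1) l _ nz k(2)] unique[OF that(1) k'(1) l _ nz k'(3)] by blast
        then show False using that(2) by blast
      qed
      have "(\<Sum>i<Suc n. A $$ (i, l) * (if P i then 1 else -1))
          = (\<Sum>i\<in>{k, k'}. A $$ (i, l) * (if P i then 1 else -1))"
        using k k' others by (intro sum.mono_neutral_right) auto
      also have "\<dots> = 0"
        \<comment> \<open>Both remaining entries are 1, and their signs are opposite.\<close>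
        using entry[OF k(1) l] entry[OF k'(1) l] k k' P by auto
      finally show "(\<Sum>i<Suc n. A $$ (i, l) * (if P i then 1 else -1)) = 0" .
    qed simp
    then show ?thesis by simp
  qed
qed

text \<open>\<open>pick\<close> enumerates in increasing order. This carries uniqueness of a row
  from a matrix over to its submatrices; the bounded set has the form in which
  \<open>submatrix\<close> counts its rows.\<close>

lemma inj_on_pick: "inj_on (pick I) {..<card {i. i < m \<and> i \<in> I}}"
proof (rule linorder_inj_onI)
  fix a b assume ab: "a < b" "a \<in> {..<card {i. i < m \<and> i \<in> I}}" "b \<in> {..<card {i. i < m \<and> i \<in> I}}"
  then show "pick I a \<noteq> pick I b"
    using pick_mono_le[of b "{i. i < m \<and> i \<in> I}" a] by (simp flip: pick_reduce_set)
qed auto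

text \<open>Both hypotheses pass to every square submatrix, with the classes pulled back along
  \<open>pick I\<close>, so the determinant bound applies to each of them.\<close>

lemma totally_unimodular_two_class_rows:
  fixes P :: "nat \<Rightarrow> bool"
  assumes entry: "\<And>k l. k < dim_row A \<Longrightarrow> l < dim_col A \<Longrightarrow> A $$ (k, l) \<in> {0, 1}"
    and unique: "\<And>k k' l. \<lbrakk>k < dim_row A; k' < dim_row A; l < dim_col A; P k = P k';
      A $$ (k, l) \<noteq> 0; A $$ (k', l) \<noteq> 0\<rbrakk> \<Longrightarrow> k = k'"
  shows "totally_unimodular A"
  unfolding totally_unimodular_def
proof (intro allI impI)
  fix I J assume I: "I \<subseteq> {..<dim_row A}" and J: "J \<subseteq> {..<dim_col A}" and card: "card I = card J"
  have [simp]: "{i. i < dim_row A \<and> i \<in> I} = I" "{j. j < dim_col A \<and> j \<in> J} = J"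
    using I J by auto
  have row: "pick I a < dim_row A" if "a < card J" for a
    using that pick_le[of a "dim_row A" I] card by simp
  have col: "pick J b < dim_col A" if "b < card J" for b
    using that pick_le[of b "dim_col A" J] by simp
  have B: "submatrix A I J $$ (a, b) = A $$ (pick I a, pick J b)" if "a < card J" "b < card J" for a b
    using that card by (simp add: submatrix_index)
  show "det (submatrix A I J) \<in> {-1, 0, 1}"
  proof (rule det_two_class_rows[of _ "card J" "\<lambda>a. P (pick I a)"])
    show "submatrix A I J \<in> carrier_mat (card J) (card J)"
      using card by (intro carrier_matI) (simp_all add: dim_submatrix)
    show "submatrix A I J $$ (a, b) \<in> {0, 1}" if "a < card J" "b < card J" for a b
      unfolding B[OF that] using that by (intro entry row col)
    show "a = a'"
      if "a < card J" "a' < card J" "b < card J" "P (pick I a) = P (pick I a')"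
        "submatrix A I J $$ (a, b) \<noteq> 0" "submatrix A I J $$ (a', b) \<noteq> 0" for a a' b
    proof -
      have "pick I a = pick I a'"
        using that by (intro unique[of _ _ "pick J b"] row col) (auto simp: B)
      then show ?thesis
        using inj_on_pick[of I "dim_row A"] that card by (simp add: inj_on_eq_iff)
    qed
  qed
qed

text \<open>Only the summand at \<open>(i, j)\<close> survives. Finiteness matters since a sum over
  an infinite set is 0 by convention.\<close>

lemma coefficient_Assignment:
  assumes "finite (S n)" "\<And>i. i \<in> S n \<Longrightarrow> finite (C i)" "(n', i, j) \<in> variables N S C"
  shows "coefficient N S C (Assignment n) (n', i, j) = of_bool (n = n')"
proof (cases "n = n'")
  case True
  have "(\<Sum>i'\<in>S n. \<Sum>j'\<in>C i'. if i' = i \<and> j' = j then 1 else 0)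
      = (\<Sum>i'\<in>S n. if i' = i then (\<Sum>j'\<in>C i. if j' = j then 1 else 0) else (0 :: real))"
    by (intro sum.cong) auto
  also have "\<dots> = 1"
    using assms True by (simp add: variables_def)
  finally show ?thesis
    using True by (simp add: coefficient_def)
qed (simp add: coefficient_def)

lemma coefficient_Capacity:
  assumes "(n, i', j') \<in> variables N S C"
  shows "coefficient N S C (Capacity i j) (n, i', j') = of_bool (i = i' \<and> j = j')"
proof (cases "i = i' \<and> j = j'")
  case True
  then have "n \<in> requests_of N S i" "finite (requests_of N S i)"
    using assms by (auto simp: variables_def requests_of_def)
  then show ?thesis
    using True by (simp add: coefficient_def)
qed (auto simp: coefficient_def intro!: sum.neutral)

theorem lemma1:
  fixes N M :: nat
    and S :: "nat \<Rightarrow> nat set"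
    and C :: "nat \<Rightarrow> 'c set"
    and rs :: "'c constraint list"
    and cs :: "(nat \<times> nat \<times> 'c) list"
  assumes "\<And>n. n \<in> {1..N} \<Longrightarrow> S n \<subseteq> {1..M}"
    and "\<And>i. i \<in> {1..M} \<Longrightarrow> finite (C i)"
    and "distinct rs" and "set rs = constraints N M C"
    and "distinct cs" and "set cs = variables N S C"
  shows "totally_unimodular (coefficient_matrix N S C rs cs)"
proof -
  let ?A = "coefficient_matrix N S C rs cs"
  \<comment> \<open>Each variable is an edge joining its assignment constraint to its capacity
    constraint, so the matrix is the incidence matrix of a bipartite graph.\<close>
  define incident :: "'c constraint \<Rightarrow> nat \<times> nat \<times> 'c \<Rightarrow> bool" where
    "incident r v = (case v of (n, i, j) \<Rightarrow> r = Assignment n \<or> r = Capacity i j)" for r v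
  have "coefficient N S C r v = of_bool (incident r v)"
    if "r \<in> constraints N M C" "v \<in> variables N S C" for r v
  proof (cases r)
    case (Assignment n)
    then have "n \<in> {1..N}" using that by (auto simp: constraints_def)
    then have "finite (S n)" "\<And>i. i \<in> S n \<Longrightarrow> finite (C i)"
      using assms(1)[of n] assms(2) by (auto intro: finite_subset)
    then show ?thesis
      using Assignment that(2) by (cases v) (auto simp: coefficient_Assignment incident_def)
  next
    case (Capacity i j)
    then show ?thesis
      using that(2) by (cases v) (auto simp: coefficient_Capacity incident_def)
  qed
  then have A: "?A $$ (k, l) = of_bool (incident (rs ! k) (cs ! l))"
    if "k < length rs" "l < length cs" for k l
    using that by (simp add: coefficient_matrix_def flip: assms(4,6))
  have dim: "dim_row ?A = length rs" "dim_col ?A = length cs"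
    by (simp_all add: coefficient_matrix_def)
  show ?thesis
  proof (rule totally_unimodular_two_class_rows[where P = "\<lambda>k. \<exists>n. rs ! k = Assignment n"],
      unfold dim)
    show "?A $$ (k, l) \<in> {0, 1}" if "k < length rs" "l < length cs" for k l
      using that by (simp add: A)
    show "k = k'"
      if "k < length rs" "k' < length rs" "l < length cs"
        "(\<exists>n. rs ! k = Assignment n) = (\<exists>n. rs ! k' = Assignment n)"
        "?A $$ (k, l) \<noteq> 0" "?A $$ (k', l) \<noteq> 0" for k k' l
    proof -
      \<comment> \<open>A triple \<open>(n, i, j)\<close> meets just \<open>Assignment n\<close> and
        \<open>Capacity i j\<close>, one in each class, so the class determines the constraint.
        Distinctness of \<open>rs\<close> then determines its position.\<close>
      have "rs ! k = rs ! k'"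
        using that by (cases "cs ! l") (auto simp: A incident_def)
      then show ?thesis
        using \<open>distinct rs\<close> that by (simp add: nth_eq_iff_index_eq)
    qed
  qed
qed

end
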